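(* Let $\mathbf a$ be a non-empty admissible composition and $\overline{\mathbf a}$ its dual composition. For all $m,n\in\mathbf N$, we have $\zeta(\mathbf a)_{m,n}=\zeta(\overline{\mathbf a})_{n,m}$.
   Context: $\mathbf N$ denotes the set of non-negative integers. A composition is a finite sequence $\mathbf a=(a_1,\ldots,a_r)$ of positive integers; it is admissible if either $r\ge1$ and $a_1\ge 2$, or $r=0$. A binary word is a finite word over $\{0,1\}$; $\{0\}_u$ denotes the word of $u$ letters $0$. The binary word associated to $\mathbf a$ is $\mathbf w(\mathbf a)=\{0\}_{a_1-1}1\cdots\{0\}_{a_r-1}1$; $\mathbf w$ is a bijection from compositions onto binary words that are empty or end with $1$. The dual of a binary word $w=\varepsilon_1\ldots\varepsilon_k$ is $\overline w=\overline{\varepsilon_k}\ldots\overline{\varepsilon_1}$ where $\overline0=1,\overline1=0$. The dual composition $\overline{\mathbf a}$ of an admissible composition $\mathbf a$ is the admissible composition with $\mathbf w(\overline{\mathbf a})=\overline{\mathbf w(\mathbf a)}$. Set $f_0(t)=1/t$, $f_1(t)=1/(1-t)$. For a non-empty admissible composition $\mathbf a$ with $\mathbf w(\mathbf a)=\varepsilon_1\ldots\varepsilon_k$ and $m,n\in\mathbf N$, the $(m,n)$-double tail is $$\zeta(\mathbf a)_{m,n}=\int_{1>t_1>\cdots>t_k>0}(1-t_1)^m f_{\varepsilon_1}(t_1)\cdots f_{\varepsilon_k}(t_k)\,t_k^n\,dt_1\cdots dt_k .$$ *)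

theory Defs
  imports "HOL-Analysis.Analysis"
begin

definition composition :: "nat list \<Rightarrow> bool" where
  "composition a \<longleftrightarrow> (\<forall>x\<in>set a. x > 0)"

definition admissible :: "nat list \<Rightarrow> bool" where
  "admissible a \<longleftrightarrow> composition a \<and> (a = [] \<or> hd a \<ge> 2)"

text \<open>Binary words are Boolean lists; \<open>False\<close> is the letter 0 and \<open>True\<close> is the letter 1.\<close>

definition word_of :: "nat list \<Rightarrow> bool list" where
  "word_of a = concat (map (\<lambda>x. replicate (x - 1) False @ [True]) a)"

definition dual_word :: "bool list \<Rightarrow> bool list" where
  "dual_word w = rev (map Not w)"

definition dual_comp :: "nat list \<Rightarrow> nat list" where
  "dual_comp a = (THE b. admissible b \<and> word_of b = dual_word (word_of a))"

definition form :: "bool \<Rightarrow> real \<Rightarrow> real" where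
  "form e t = (if e then 1 / (1 - t) else 1 / t)"

text \<open>Coordinates are numbered from 0, so \<open>t\<^sub>i\<close> is \<open>t (i - 1)\<close>; the conditions below are
  \<open>1 > t\<^sub>1 > \<dots> > t\<^sub>k > 0\<close>.\<close>

definition ordered_simplex :: "nat \<Rightarrow> (nat \<Rightarrow> real) set" where
  "ordered_simplex k = {t \<in> {..<k} \<rightarrow>\<^sub>E UNIV.
     (\<forall>i<k. 0 < t i \<and> t i < 1) \<and> (\<forall>i j. i < j \<and> j < k \<longrightarrow> t j < t i)}"

definition double_tail_integrand :: "bool list \<Rightarrow> nat \<Rightarrow> nat \<Rightarrow> (nat \<Rightarrow> real) \<Rightarrow> real" where
  "double_tail_integrand w m n t =
     (1 - t 0) ^ m * (\<Prod>i<length w. form (w ! i) (t i)) * t (length w - 1) ^ n"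

definition double_tail :: "nat list \<Rightarrow> nat \<Rightarrow> nat \<Rightarrow> real" where
  "double_tail a m n =
     (let w = word_of a; k = length w
      in LINT t:ordered_simplex k|(\<Pi>\<^sub>M i\<in>{..<k}. lborel). double_tail_integrand w m n t)"

lemma word_of_Nil [simp]: "word_of [] = []"
  by (simp add: word_of_def)

lemma word_of_Cons: "word_of (x # a) = replicate (x - 1) False @ True # word_of a"
  by (simp add: word_of_def)

lemma word_of_eq_Nil_iff [simp]: "word_of a = [] \<longleftrightarrow> a = []"
  by (cases a) (simp_all add: word_of_Cons)

lemma last_word_of: "a \<noteq> [] \<Longrightarrow> last (word_of a)"
  by (induction a) (auto simp: word_of_Cons)

lemma hd_word_of:
  assumes "composition a" "a \<noteq> []"
  shows "hd (word_of a) \<longleftrightarrow> hd a = 1"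
proof (cases a)
  case (Cons x b)
  then show ?thesis
    using assms by (cases "x - 1") (auto simp: word_of_Cons composition_def)
qed (use assms in simp)

lemma word_of_inject:
  assumes "composition a" "composition b" "word_of a = word_of b"
  shows "a = b"
  using assms
proof (induction a arbitrary: b)
  case Nil
  then have "word_of b = []" by simp
  then show ?case by simp
next
  case (Cons x a)
  then obtain y c where b: "b = y # c"
    by (cases b) (auto simp: word_of_Cons)
  have eq: "replicate (x - 1) False @ True # word_of a = replicate (y - 1) False @ True # word_of c"
    using Cons.prems(3) by (simp add: b word_of_Cons)
  have tw: "takeWhile Not (replicate j False @ True # u) = replicate j False" for j u
    by (induction j) auto
  have "replicate (x - 1) False = replicate (y - 1) False"
    using arg_cong[OF eq, of "takeWhile Not"] by (simp add: tw)
  then have "x - 1 = y - 1"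
    using length_replicate by metis
  moreover have "x > 0" "y > 0" using Cons.prems(1,2) by (auto simp: b composition_def)
  ultimately have xy: "x = y" by linarith
  with eq have "word_of a = word_of c" by simp
  then show ?case
    using Cons.IH[of c] Cons.prems(1,2) by (simp add: b xy composition_def)
qed

lemma word_of_surj:
  assumes "w = [] \<or> last w"
  shows "\<exists>a. composition a \<and> word_of a = w"
  using assms
proof (induction w)
  case Nil
  show ?case by (rule exI[of _ "[]"]) (simp add: composition_def)
next
  case (Cons e w)
  show ?case
  proof (cases "w = []")
    case True
    with Cons.prems show ?thesis
      by (intro exI[of _ "[1]"]) (simp add: composition_def word_of_Cons)
  next
    case False
    with Cons.prems have "last w" by simp
    with Cons.IH obtain a where a: "composition a" "word_of a = w" by blast
    with False obtain x c where xc: "a = x # c" by (cases a) auto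
    show ?thesis
    proof (cases e)
      case True
      with a show ?thesis
        by (intro exI[of _ "1 # a"]) (simp add: composition_def word_of_Cons)
    next
      case False
      from a xc obtain y where "x = Suc y" by (cases x) (auto simp: composition_def)
      with False a xc show ?thesis
        by (intro exI[of _ "Suc x # c"]) (auto simp: composition_def word_of_Cons)
    qed
  qed
qed

lemma dual_comp_ex1:
  assumes "admissible a"
  shows "\<exists>!b. admissible b \<and> word_of b = dual_word (word_of a)"
proof -
  have comp: "composition a" using assms by (simp add: admissible_def)
  have "\<exists>b. admissible b \<and> word_of b = dual_word (word_of a)"
  proof (cases "a = []")
    case True
    then show ?thesis
      by (intro exI[of _ "[]"]) (simp add: admissible_def composition_def dual_word_def)
  next
    case False
    then have ne: "word_of a \<noteq> []" by simp
    have h: "\<not> hd (word_of a)"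
      using assms False hd_word_of[OF comp False] by (simp add: admissible_def)
    then have "last (dual_word (word_of a))"
      using ne by (simp add: dual_word_def last_rev hd_map)
    then obtain b where b: "composition b" "word_of b = dual_word (word_of a)"
      using word_of_surj by blast
    have bne: "b \<noteq> []" using b(2) ne by (auto simp: dual_word_def)
    have "\<not> hd (word_of b)"
      using last_word_of[OF False] ne by (simp add: b(2) dual_word_def hd_rev last_map)
    then have "hd b \<noteq> 1" using hd_word_of[OF b(1) bne] by simp
    moreover have "hd b > 0" using b(1) bne by (simp add: composition_def)
    ultimately have "admissible b" using b(1) by (simp add: admissible_def)
    with b(2) show ?thesis by blast
  qed
  then show ?thesis
    by (metis admissible_def word_of_inject)
qed

lemma dual_comp_props:
  assumes "admissible a"
  shows "admissible (dual_comp a)" "word_of (dual_comp a) = dual_word (word_of a)"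
  using theI'[OF dual_comp_ex1[OF assms]] by (simp_all add: dual_comp_def)

lemma prod_inverse_le:
  fixes x :: "nat \<Rightarrow> real"
  assumes x: "\<And>i. i < k \<Longrightarrow> 0 < x i \<and> x i < 1"
    and S: "S \<subseteq> {..<k}" and q: "q < k" "q \<notin> S"
    and le: "\<And>i. i \<in> S \<Longrightarrow> x q \<le> x i"
  shows "(\<Prod>i\<in>S. 1 / x i) \<le> (\<Prod>i<k. x i powr (1 / real k - 1))"
proof -
  define d where "d = 1 / real k"
  have k: "k > 0" using q by simp
  have d: "d > 0" "d \<le> 1" "d * real k = 1" using k by (auto simp: d_def)
  have finS: "finite S" using S finite_subset by blast
  have xq: "0 < x q" "x q < 1" using x q by auto
  have xS: "0 < x i \<and> x i < 1" if "i \<in> S" for i using that S x by auto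
  have "S \<subset> {..<k}" using S q by auto
  then have "card S < k" by (metis card_lessThan finite_lessThan psubset_card_mono)
  then have "d * real (card S) \<le> d * (real k - 1)"
    using d by (intro mult_left_mono) auto
  then have cS: "d * real (card S) \<le> 1 - d" using d by (simp add: algebra_simps)
  have "(\<Prod>i\<in>S. 1 / x i) \<le> (\<Prod>i\<in>S. x i powr (d - 1) * x q powr (- d))"
  proof (intro prod_mono conjI)
    fix i assume i: "i \<in> S"
    have "1 / x i = x i powr ((d - 1) + (- d))"
      using xS[OF i] by (simp add: powr_minus_divide)
    also have "\<dots> = x i powr (d - 1) * x i powr (- d)"
      by (rule powr_add)
    also have "\<dots> \<le> x i powr (d - 1) * x q powr (- d)"
      using xq le[OF i] d by (intro mult_left_mono powr_mono2') auto
    finally show "1 / x i \<le> x i powr (d - 1) * x q powr (- d)" .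
    show "0 \<le> 1 / x i" using xS[OF i] by simp
  qed
  also have "\<dots> = (\<Prod>i\<in>S. x i powr (d - 1)) * x q powr (- (d * real (card S)))"
    using xq by (simp add: prod.distrib powr_power mult.commute)
  also have "\<dots> \<le> (\<Prod>i\<in>S. x i powr (d - 1)) * x q powr (d - 1)"
    using xq cS by (intro mult_left_mono powr_mono' prod_nonneg) auto
  also have "\<dots> = (\<Prod>i\<in>insert q S. x i powr (d - 1))"
    using finS q by (simp add: mult.commute)
  also have "\<dots> \<le> (\<Prod>i<k. x i powr (d - 1))"
  proof (rule prod_mono2)
    show "1 \<le> x i powr (d - 1)" if "i \<in> {..<k} - insert q S" for i
      using powr_mono'[of "d - 1" 0 "x i"] x[of i] that d by auto
  qed (use S q in auto)
  finally show ?thesis by (simp add: d_def)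
qed

lemma sets_ordered_simplex: "ordered_simplex k \<in> sets (\<Pi>\<^sub>M i\<in>{..<k}. lborel)"
proof -
  let ?M = "\<Pi>\<^sub>M i\<in>{..<k}. (lborel :: real measure)"
  have comp: "(\<lambda>t. t i) \<in> borel_measurable ?M" if "i < k" for i
    using measurable_component_singleton[of i "{..<k}" "\<lambda>_. lborel"] that by simp
  have eq: "ordered_simplex k = {t \<in> space ?M.
      (\<forall>i\<in>{..<k}. 0 < t i \<and> t i < 1) \<and> (\<forall>j\<in>{..<k}. \<forall>i\<in>{..<j}. t j < t i)}"
    unfolding ordered_simplex_def space_PiM by auto
  show ?thesis
    unfolding eq
    by (intro sets.sets_Collect_conj sets.sets_Collect_finite_All borel_measurable_less
        borel_measurable_const comp finite_lessThan) auto
qed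

text \<open>The integral defining \<open>double_tail\<close> converges absolutely for non-empty admissible
  compositions, so it never takes the default value 0 of a divergent integral there. The integrand is
  dominated by a product of Beta densities with both exponents \<open>1/k - 1\<close>.\<close>

lemma double_tail_integrable:
  assumes "admissible a" "a \<noteq> []"
  defines "w \<equiv> word_of a"
  defines "k \<equiv> length w"
  shows "set_integrable (\<Pi>\<^sub>M i\<in>{..<k}. lborel) (ordered_simplex k) (double_tail_integrand w m n)"
proof -
  let ?M = "\<Pi>\<^sub>M i\<in>{..<k}. (lborel :: real measure)"
  interpret product_sigma_finite "\<lambda>_ :: nat. lborel :: real measure"
    by standard
  define d where "d = 1 / real k"
  have ne: "w \<noteq> []" and k: "k > 0" using assms(2) by (auto simp: w_def k_def)
  have w0: "\<not> w ! 0"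
    using hd_word_of[of a] assms(1,2) ne by (auto simp: admissible_def w_def hd_conv_nth)
  have wl: "w ! (k - 1)"
    using last_word_of[OF assms(2)] ne by (simp add: k_def w_def last_conv_nth)
  define h :: "real \<Rightarrow> real" where
    "h = (\<lambda>t. indicator {0..1} t * (t powr (d - 1) * (1 - t) powr (d - 1)))"
  have "integrable lborel h"
    using integrable_Beta[of d d] k by (simp add: h_def set_integrable_def d_def)
  then have H: "integrable ?M (\<lambda>t. \<Prod>i<k. h (t i))"
    by (intro product_integrable_prod) auto
  have comp: "(\<lambda>t. t i) \<in> borel_measurable ?M" if "i < k" for i
    using measurable_component_singleton[of i "{..<k}" "\<lambda>_. lborel"] that by simp
  have [measurable]: "(\<lambda>t. t 0) \<in> borel_measurable ?M"
    "(\<lambda>t. t (k - 1)) \<in> borel_measurable ?M"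
    using comp k by auto
  have "(\<lambda>t. form (w ! i) (t i)) \<in> borel_measurable ?M" if "i < k" for i
    using comp[OF that] by (cases "w ! i") (simp_all add: form_def)
  then have [measurable]: "(\<lambda>t. \<Prod>i<k. form (w ! i) (t i)) \<in> borel_measurable ?M"
    by (intro borel_measurable_prod) auto
  have meas: "double_tail_integrand w m n \<in> borel_measurable ?M"
    unfolding double_tail_integrand_def k_def[symmetric] by measurable
  have bound: "norm (double_tail_integrand w m n t) \<le> (\<Prod>i<k. h (t i))"
    if t: "t \<in> ordered_simplex k" for t
  proof -
    have t01: "0 < t i \<and> t i < 1" if "i < k" for i
      using t that by (auto simp: ordered_simplex_def)
    have dec: "t j \<le> t i" if "i \<le> j" "j < k" for i j
      using t that by (cases "i = j") (auto simp: ordered_simplex_def less_imp_le)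
    let ?I0 = "{i\<in>{..<k}. \<not> w ! i}" and ?I1 = "{i\<in>{..<k}. w ! i}"
    have fpos: "0 \<le> form (w ! i) (t i)" if "i < k" for i
      using t01[OF that] by (simp add: form_def)
    have P: "0 \<le> (\<Prod>i<k. form (w ! i) (t i))"
      using fpos by (intro prod_nonneg) auto
    have "norm (double_tail_integrand w m n t)
        = (1 - t 0) ^ m * (\<Prod>i<k. form (w ! i) (t i)) * t (k - 1) ^ n"
      using P t01[of 0] t01[of "k - 1"] k
      by (simp add: double_tail_integrand_def k_def[symmetric] abs_mult)
    also have "\<dots> \<le> 1 * (\<Prod>i<k. form (w ! i) (t i)) * 1"
      using P t01[of 0] t01[of "k - 1"] k
      by (intro mult_mono power_le_one mult_nonneg_nonneg) auto
    also have "\<dots> = (\<Prod>i\<in>?I1. 1 / (1 - t i)) * (\<Prod>i\<in>?I0. 1 / t i)"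
    proof -
      have "{..<k} \<inter> {i. w ! i} = ?I1" "{..<k} \<inter> - {i. w ! i} = ?I0" by auto
      then show ?thesis
        by (simp add: form_def prod.If_cases)
    qed
    also have "\<dots> \<le> (\<Prod>i<k. (1 - t i) powr (d - 1)) * (\<Prod>i<k. t i powr (d - 1))"
    proof (rule mult_mono)
      show "(\<Prod>i\<in>?I1. 1 / (1 - t i)) \<le> (\<Prod>i<k. (1 - t i) powr (d - 1))"
        unfolding d_def by (rule prod_inverse_le[where q = 0]) (use t01 dec k w0 in auto)
      show "(\<Prod>i\<in>?I0. 1 / t i) \<le> (\<Prod>i<k. t i powr (d - 1))"
        unfolding d_def by (rule prod_inverse_le[where q = "k - 1"]) (use t01 dec k wl in auto)
      show "0 \<le> (\<Prod>i<k. (1 - t i) powr (d - 1))"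
        by (intro prod_nonneg) auto
      show "0 \<le> (\<Prod>i\<in>?I0. 1 / t i)"
        using t01 by (intro prod_nonneg) (auto simp: less_imp_le)
    qed
    also have "\<dots> = (\<Prod>i<k. h (t i))"
      unfolding prod.distrib[symmetric]
      using t01 by (intro prod.cong) (auto simp: h_def less_imp_le)
    finally show ?thesis .
  qed
  show ?thesis
    unfolding set_integrable_def
  proof (rule Bochner_Integration.integrable_bound[OF H])
    show "(\<lambda>t. indicator (ordered_simplex k) t *\<^sub>R double_tail_integrand w m n t)
        \<in> borel_measurable ?M"
      using sets_ordered_simplex meas by (intro borel_measurable_scaleR borel_measurable_indicator) auto
    show "AE t in ?M. norm (indicator (ordered_simplex k) t *\<^sub>R double_tail_integrand w m n t)
        \<le> norm (\<Prod>i<k. h (t i))"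
    proof (intro AE_I2)
      fix t
      show "norm (indicator (ordered_simplex k) t *\<^sub>R double_tail_integrand w m n t)
          \<le> norm (\<Prod>i<k. h (t i))"
        using bound[of t] by (cases "t \<in> ordered_simplex k") auto
    qed
  qed
qed

end

theory Submission
  imports Defs
begin

text \<open>The substitution \<open>s\<^sub>i = 1 - t\<^sub>k\<^sub>+\<^sub>1\<^sub>-\<^sub>i\<close> preserves Lebesgue measure and the ordered
  simplex; it exchanges \<open>dt/t\<close> with \<open>dt/(1-t)\<close> while reversing their order, and carries
  \<open>(1 - t\<^sub>1)\<^sup>m t\<^sub>k\<^sup>n\<close> to \<open>s\<^sub>k\<^sup>m (1 - s\<^sub>1)\<^sup>n\<close>.\<close>

text \<open>A finite product of sigma-finite measures is determined by its values on boxes. The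
  preimage of a box under this map is again a box, and since \<open>f\<close> preserves
  \<open>M\<close> its sides have the original measures in permuted order, which leaves their
  product unchanged.\<close>

lemma distr_PiM_permute_map:
  assumes M: "sigma_finite_measure M" and I: "finite I"
    and f [measurable]: "f \<in> M \<rightarrow>\<^sub>M M" and distr_f: "distr M M f = M"
    and p: "bij_betw p I I"
  shows "distr (\<Pi>\<^sub>M i\<in>I. M) (\<Pi>\<^sub>M i\<in>I. M) (\<lambda>t. \<lambda>i\<in>I. f (t (p i))) = (\<Pi>\<^sub>M i\<in>I. M)"
    (is "distr ?P ?P ?g = ?P")
proof -
  interpret product_sigma_finite "\<lambda>_. M"
    using M by (simp add: product_sigma_finite_def)
  have pI: "p i \<in> I" if "i \<in> I" for i using p that by (rule bij_betw_apply)
  have g: "?g \<in> ?P \<rightarrow>\<^sub>M ?P"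
  proof (rule measurable_restrict)
    fix i assume "i \<in> I"
    then have "(\<lambda>t. t (p i)) \<in> ?P \<rightarrow>\<^sub>M M"
      using pI by (intro measurable_component_singleton)
    then show "(\<lambda>t. f (t (p i))) \<in> ?P \<rightarrow>\<^sub>M M" by measurable
  qed
  show ?thesis
  proof (rule PiM_eqI[OF I])
    fix A assume A: "\<And>i. i \<in> I \<Longrightarrow> A i \<in> sets M"
    define q where "q = the_inv_into I p"
    have q: "bij_betw q I I"
      using p by (simp add: q_def bij_betw_the_inv_into)
    have qp: "q (p i) = i" if "i \<in> I" for i
      using p that by (simp add: q_def bij_betw_def the_inv_into_f_f)
    have pq: "p (q j) = j" if "j \<in> I" for j
      using p that by (simp add: q_def f_the_inv_into_f_bij_betw)
    have qI: "q i \<in> I" if "i \<in> I" for i using q that by (rule bij_betw_apply)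
    \<comment> \<open>Coordinate \<open>j\<close> of the argument enters the image only at index
      \<open>q j\<close>, the inverse image of \<open>j\<close> under \<open>p\<close>; hence
      \<open>A (q j)\<close> is the only side that constrains it.\<close>
    define B where "B j = f -` A (q j) \<inter> space M" for j
    have B: "B j \<in> sets M" if "j \<in> I" for j
      using A[OF qI[OF that]] unfolding B_def by (rule measurable_sets[OF f])
    have emB: "emeasure M (B j) = emeasure M (A (q j))" if "j \<in> I" for j
      using emeasure_distr[OF f A[OF qI[OF that]]] by (simp add: B_def distr_f)
    have "?g -` Pi\<^sub>E I A \<inter> space ?P = Pi\<^sub>E I B"
    proof (intro set_eqI iffI)
      fix t assume t: "t \<in> ?g -` Pi\<^sub>E I A \<inter> space ?P"
      have "t j \<in> B j" if "j \<in> I" for j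
      proof -
        have "?g t (q j) \<in> A (q j)" using t qI[OF that] by blast
        then show ?thesis
          using t that by (auto simp: B_def space_PiM qI pq)
      qed
      then show "t \<in> Pi\<^sub>E I B" using t by (auto simp: space_PiM)
    next
      fix t assume t: "t \<in> Pi\<^sub>E I B"
      have "f (t (p i)) \<in> A i" if "i \<in> I" for i
        using PiE_mem[OF t pI[OF that]] that by (simp add: B_def qp)
      then show "t \<in> ?g -` Pi\<^sub>E I A \<inter> space ?P"
        using t by (auto simp: space_PiM B_def PiE_iff)
    qed
    then have "emeasure (distr ?P ?P ?g) (Pi\<^sub>E I A) = emeasure ?P (Pi\<^sub>E I B)"
      using A I by (subst emeasure_distr[OF g]) (auto intro!: sets_PiM_I_finite)
    also have "\<dots> = (\<Prod>j\<in>I. emeasure M (A (q j)))"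
      using B I by (simp add: emeasure_PiM emB)
    also have "\<dots> = (\<Prod>i\<in>I. emeasure M (A i))"
      by (rule prod.reindex_bij_betw[OF q])
    finally show "emeasure (distr ?P ?P ?g) (Pi\<^sub>E I A) = (\<Prod>i\<in>I. emeasure M (A i))" .
  qed simp
qed

lemma distr_lborel_one_minus: "distr lborel lborel (\<lambda>x::real. 1 - x) = lborel"
proof -
  have "distr lborel lborel (\<lambda>x::real. 1 - x) = distr lborel borel (\<lambda>x. 1 - x)"
    by (rule distr_cong) simp_all
  also have "\<dots> = lborel"
    \<comment> \<open>The affine map has slope -1, so its density factor is |-1| = 1.\<close>
    using lborel_real_affine[of "-1" 1] by (simp add: density_1)
  finally show ?thesis .
qed

lemma bij_betw_reverse_lessThan: "bij_betw (\<lambda>i. k - Suc i) {..<k} {..<k}"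
  by (rule bij_betwI[where g = "\<lambda>i. k - Suc i"]) auto

text \<open>With coordinates numbered from 0, the index k+1-i of the substitution becomes
  \<open>k - Suc i\<close>. The restriction to \<open>{..<k}\<close> keeps the values extensional,
  as points of the product space must be.\<close>

definition flip :: "nat \<Rightarrow> (nat \<Rightarrow> real) \<Rightarrow> nat \<Rightarrow> real" where
  "flip k t = (\<lambda>i\<in>{..<k}. 1 - t (k - Suc i))"

text \<open>Reversing the indices and passing from x to 1-x each reverse the order, so together they
  preserve the chain of inequalities.\<close>

lemma flip_in_ordered_simplex:
  assumes "t \<in> ordered_simplex k"
  shows "flip k t \<in> ordered_simplex k"
  using assms by (auto simp: ordered_simplex_def flip_def)

lemma flip_flip:
  assumes "t \<in> {..<k} \<rightarrow>\<^sub>E UNIV"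
  shows "flip k (flip k t) = t"
proof
  fix i
  show "flip k (flip k t) i = t i"
    using assms by (cases "i < k") (auto simp: flip_def PiE_arb[OF assms])
qed

text \<open>The involution turns invariance of the simplex into an equivalence, so the indicator of
  the simplex is unchanged by \<open>flip k\<close>.\<close>

lemma flip_in_ordered_simplex_iff:
  assumes "t \<in> {..<k} \<rightarrow>\<^sub>E UNIV"
  shows "flip k t \<in> ordered_simplex k \<longleftrightarrow> t \<in> ordered_simplex k"
  using flip_in_ordered_simplex flip_flip[OF assms] by metis

text \<open>The identity \<open>form (\<not> e) (1 - x) = form e x\<close> holds for every real x,
  also where a denominator vanishes and division returns 0; hence the equality is pointwise on all
  \<open>t\<close>.\<close>

lemma double_tail_integrand_flip:
  assumes "w \<noteq> []"
  shows "double_tail_integrand (dual_word w) n m (flip (length w) t)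
    = double_tail_integrand w m n t"
proof -
  define k where "k = length w"
  have k: "k > 0" using assms by (simp add: k_def)
  have "(\<Prod>i<k. form (dual_word w ! i) (flip k t i))
      = (\<Prod>i<k. form (w ! (k - Suc i)) (t (k - Suc i)))"
    by (intro prod.cong) (auto simp: dual_word_def k_def rev_nth flip_def form_def)
  also have "\<dots> = (\<Prod>i<k. form (w ! i) (t i))"
    by (rule prod.reindex_bij_betw[OF bij_betw_reverse_lessThan])
  finally have P: "(\<Prod>i<k. form (dual_word w ! i) (flip k t i)) = (\<Prod>i<k. form (w ! i) (t i))" .
  have len: "length (dual_word w) = k" by (simp add: dual_word_def k_def)
  have "flip k t 0 = 1 - t (k - 1)" "flip k t (k - 1) = 1 - t 0"
    using k by (simp_all add: flip_def)
  then show ?thesis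
    unfolding double_tail_integrand_def len k_def[symmetric] P by simp
qed

theorem theorem2:
  fixes a :: "nat list" and m n :: nat
  assumes "admissible a" and "a \<noteq> []"
  shows "double_tail a m n = double_tail (dual_comp a) n m"
proof -
  define w where "w = word_of a"
  define k where "k = length w"
  let ?P = "\<Pi>\<^sub>M i\<in>{..<k}. (lborel :: real measure)"
  let ?F = "\<lambda>t. indicator (ordered_simplex k) t *\<^sub>R double_tail_integrand (dual_word w) n m t"
  have w: "w \<noteq> []" using assms(2) by (simp add: w_def)
  have dual: "admissible (dual_comp a)" "word_of (dual_comp a) = dual_word w"
    using dual_comp_props[OF assms(1)] by (simp_all add: w_def)
  have len: "length (dual_word w) = k" by (simp add: dual_word_def k_def)
  have "dual_word w \<noteq> []" using w by (simp add: dual_word_def)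
  then have "dual_comp a \<noteq> []" using dual(2) by auto
  \<comment> \<open>Convergence for the dual composition supplies the measurability of
    \<open>?F\<close> that the change of variables requires.\<close>
  then have "integrable ?P ?F"
    using double_tail_integrable[OF dual(1), of n m] by (simp add: dual(2) len set_integrable_def)
  then have F: "?F \<in> borel_measurable ?P" by (rule borel_measurable_integrable)
  have distr: "distr ?P ?P (flip k) = ?P"
    unfolding flip_def
    by (rule distr_PiM_permute_map[OF _ _ _ distr_lborel_one_minus bij_betw_reverse_lessThan])
      (auto intro: lborel.sigma_finite_measure_axioms)
  have flip: "flip k \<in> ?P \<rightarrow>\<^sub>M ?P"
    unfolding flip_def
  proof (rule measurable_restrict)
    fix i assume "i \<in> {..<k}"
    then have "(\<lambda>t. t (k - Suc i)) \<in> ?P \<rightarrow>\<^sub>M lborel"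
      by (intro measurable_component_singleton) auto
    then show "(\<lambda>t. 1 - t (k - Suc i)) \<in> ?P \<rightarrow>\<^sub>M lborel" by simp
  qed
  \<comment> \<open>By invariance, \<open>?P\<close> may be replaced by its image under
    \<open>flip k\<close>, and the integral is then pulled back along this map.\<close>
  have "double_tail (dual_comp a) n m = integral\<^sup>L (distr ?P ?P (flip k)) ?F"
    by (simp add: double_tail_def Let_def dual(2) len set_lebesgue_integral_def distr)
  also have "\<dots> = (LINT t|?P. ?F (flip k t))"
    by (rule integral_distr[OF flip F])
  also have "\<dots> = (LINT t|?P. indicator (ordered_simplex k) t *\<^sub>R double_tail_integrand w m n t)"
  proof (rule Bochner_Integration.integral_cong)
    fix t assume "t \<in> space ?P"
    then have "t \<in> {..<k} \<rightarrow>\<^sub>E UNIV" by (simp add: space_PiM)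
    then show "?F (flip k t) = indicator (ordered_simplex k) t *\<^sub>R double_tail_integrand w m n t"
      using double_tail_integrand_flip[OF w, of n m t] flip_in_ordered_simplex_iff[of t k]
      by (simp add: k_def indicator_def)
  qed simp
  also have "\<dots> = double_tail a m n"
    by (simp add: double_tail_def Let_def w_def k_def set_lebesgue_integral_def)
  finally show ?thesis by simp
qed

end
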